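(* For every integer $n\ge 0$ and every set $P$ of $n$ points in convex position in the plane, $\mathbb{R}^2\setminus P$ can be covered by (i.e. is the union of) at most $\lfloor\frac{n+5}{2}\rfloor-\delta(n)$ convex subsets of $\mathbb{R}^2\setminus P$, where $\delta(n)=1$ for $n\in\{0,1,3\}$ and $\delta(n)=0$ otherwise. That is, $cov^c(n)\le\lfloor\frac{n+5}{2}\rfloor-\delta(n)$.
   Context: A set of points is in convex position if no point lies in the convex hull of the others. $cov^c(n)$ is the maximum, over all $n$-point sets $P$ in convex position in the plane, of the smallest number of convex subsets of $\mathbb{R}^2\setminus P$ whose union is $\mathbb{R}^2\setminus P$. *)

theory Defs
  imports "HOL-Analysis.Analysis" "HOL-Library.Extended_Nat"
begin

definition convex_position :: "(real ^ 2) set \<Rightarrow> bool" where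
  "convex_position P \<longleftrightarrow> (\<forall>p\<in>P. p \<notin> convex hull (P - {p}))"

definition convex_cover :: "(real ^ 2) set \<Rightarrow> (real ^ 2) set set \<Rightarrow> bool" where
  "convex_cover P F \<longleftrightarrow> (\<forall>C\<in>F. convex C \<and> C \<subseteq> - P) \<and> \<Union>F = - P"

text \<open>The minimum and the maximum are taken in \<^typ>\<open>enat\<close>: the infimum is \<^term>\<open>\<infinity> :: enat\<close> if
  there is no finite cover, and the supremum is \<^term>\<open>\<infinity> :: enat\<close> if the values are unbounded.
  Any other value is attained, as every nonempty set of extended naturals has a least element and
  every nonempty set with a finite supremum has a greatest one.\<close>

definition cov :: "(real ^ 2) set \<Rightarrow> enat" where
  "cov P = Inf {enat (card F) | F. finite F \<and> convex_cover P F}"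

definition covc :: "nat \<Rightarrow> enat" where
  "covc n = Sup {cov P | P. finite P \<and> card P = n \<and> convex_position P}"

definition delta :: "nat \<Rightarrow> nat" where
  "delta n = (if n \<in> {0, 1, 3} then 1 else 0)"

end

theory Submission
  imports Defs
begin

text \<open>Since \<open>P\<close> is in convex position, \<open>convex hull P - P\<close> is convex, so it remains to cover the rest
  of the plane. Cut the plane along the line through an edge \<open>ab\<close> of the hull. The segment \<open>ab\<close> lies
  in the hull, the outer open half-plane together with one of the two remaining rays is a convex set
  of the cover, and the inner open half-plane together with the other ray is a convex set that
  contains the other \<open>n - 2\<close> points. Iterating, two points cost one set; a final single point costs
  two sets, and no point costs one. For a triangle the hull is not needed as an extra set: two
  half-planes beyond two of the sides, with a ray each, and the cone between them without its apex
  suffice.\<close>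

section \<open>Half-planes with a boundary ray\<close>

text \<open>The points whose pair \<open>(m \<bullet> x, d \<bullet> x)\<close> exceeds
  \<open>(c, e)\<close> lexicographically. In the plane, with \<open>m\<close> and \<open>d\<close>
  orthogonal and nonzero, this is an open half-plane plus an open ray of its boundary line.\<close>

definition lex_halfspace :: "'a::real_inner \<Rightarrow> real \<Rightarrow> 'a \<Rightarrow> real \<Rightarrow> 'a set" where
  "lex_halfspace m c d e = {x. m \<bullet> x > c \<or> m \<bullet> x = c \<and> d \<bullet> x > e}"

lemma convex_lex_halfspace: "convex (lex_halfspace m c d e)"
proof (rule convexI)
  fix x y and s t :: real
  assume x: "x \<in> lex_halfspace m c d e" and y: "y \<in> lex_halfspace m c d e"
    and s: "0 \<le> s" and t: "0 \<le> t" and st: "s + t = 1"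
  show "s *\<^sub>R x + t *\<^sub>R y \<in> lex_halfspace m c d e"
  proof (cases "s = 0 \<or> t = 0")
    case True
    then show ?thesis using x y st by auto
  next
    case False
    then have pos: "s > 0" "t > 0" using s t by auto
    \<comment> \<open>With both weights positive, one strict inequality suffices. This is applied to
      \<open>d\<close> if both points lie on the boundary, and to \<open>m\<close>
      otherwise.\<close>
    have less: "k < s * p + t * q" if "k \<le> p" "k \<le> q" "k < p \<or> k < q" for k p q :: real
    proof -
      have "s * (p - k) + t * (q - k) > 0"
        using that pos by (auto intro: add_pos_nonneg add_nonneg_pos)
      moreover have "s * k + t * k = k" using st by (metis distrib_right mult_1)
      ultimately show ?thesis by (simp add: algebra_simps)
    qed
    show ?thesis
    proof (cases "m \<bullet> x = c \<and> m \<bullet> y = c")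
      case True
      moreover have "s * c + t * c = c" using st by (metis distrib_right mult_1)
      ultimately show ?thesis
        using x y less[of e "d \<bullet> x" "d \<bullet> y"] by (auto simp: lex_halfspace_def inner_add_right)
    next
      case False
      then show ?thesis
        using x y less[of c "m \<bullet> x" "m \<bullet> y"] by (auto simp: lex_halfspace_def inner_add_right)
    qed
  qed
qed

section \<open>Normals and parallel vectors in the plane\<close>

lemma inner_vec2: "(x :: real ^ 2) \<bullet> y = x $ 1 * y $ 1 + x $ 2 * y $ 2"
  by (simp add: inner_vec_def sum_2)

lemma orthogonal_vector_exists:
  fixes v :: "real ^ 2"
  assumes "v \<noteq> 0"
  obtains w where "w \<noteq> 0" "w \<bullet> v = 0"
proof
  show "vector [- (v $ 2), v $ 1] \<noteq> (0 :: real ^ 2)"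
    using assms by (auto simp: vec_eq_iff forall_2)
  show "vector [- (v $ 2), v $ 1] \<bullet> v = 0"
    by (simp add: inner_vec2)
qed

text \<open>The nonzero \<open>m\<close> is annihilated by the matrix with rows \<open>v\<close> and
  \<open>d\<close>, so its determinant vanishes.\<close>

lemma parallel_if_common_normal:
  fixes m v d :: "real ^ 2"
  assumes "m \<noteq> 0" "d \<noteq> 0" "m \<bullet> v = 0" "m \<bullet> d = 0"
  obtains r where "v = r *\<^sub>R d"
proof -
  have "m $ 1 \<noteq> 0 \<or> m $ 2 \<noteq> 0" using assms(1) by (auto simp: vec_eq_iff forall_2)
  moreover have "m $ 1 * (v $ 1 * d $ 2 - v $ 2 * d $ 1) = 0" "m $ 2 * (v $ 1 * d $ 2 - v $ 2 * d $ 1) = 0"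
    using assms(3,4) unfolding inner_vec2 by algebra+
  ultimately have det: "v $ 1 * d $ 2 = v $ 2 * d $ 1" by auto
  have "d $ 1 \<noteq> 0 \<or> d $ 2 \<noteq> 0" using assms(2) by (auto simp: vec_eq_iff forall_2)
  then show thesis
  proof
    assume "d $ 1 \<noteq> 0"
    then have "v = (v $ 1 / d $ 1) *\<^sub>R d" using det by (simp add: vec_eq_iff forall_2 field_simps)
    then show thesis by (rule that)
  next
    assume "d $ 2 \<noteq> 0"
    then have "v = (v $ 2 / d $ 2) *\<^sub>R d" using det by (simp add: vec_eq_iff forall_2 field_simps)
    then show thesis by (rule that)
  qed
qed

section \<open>Points in convex position\<close>

lemma convex_position_subset:
  assumes "convex_position P" "Q \<subseteq> P"
  shows "convex_position Q"
  unfolding convex_position_def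
proof
  fix p assume "p \<in> Q"
  moreover have "convex hull (Q - {p}) \<subseteq> convex hull (P - {p})"
    using assms(2) by (intro hull_mono) auto
  ultimately show "p \<notin> convex hull (Q - {p})"
    using assms unfolding convex_position_def by blast
qed

text \<open>Convex position makes each point of \<open>P\<close> an extreme point of the hull, so no
  open segment between points of the hull meets \<open>P\<close>.\<close>

lemma convex_hull_minus_points:
  assumes fin: "finite P" and "convex_position P"
  shows "convex (convex hull P - P)"
proof -
  have extreme: "p extreme_point_of (convex hull P)" if "p \<in> P" for p
    using extreme_point_of_convex_hull_convex_independent[of P p] that assms
    by (auto simp: convex_position_def finite_imp_compact)
  show ?thesis
  proof (rule convex_contains_open_segment[THEN iffD2], intro ballI subsetI)
    fix x y z assume xy: "x \<in> convex hull P - P" "y \<in> convex hull P - P"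
      and z: "z \<in> open_segment x y"
    then have "z \<in> convex hull P"
      using convex_contains_open_segment[of "convex hull P"] by auto
    moreover have "z \<notin> P"
      using extreme[of z] xy z by (auto simp: extreme_point_of_def)
    ultimately show "z \<in> convex hull P - P" by blast
  qed
qed

lemma convex_position_not_between:
  assumes "convex_position P" "a \<in> P" "b \<in> P" "p \<in> P" "p \<noteq> a" "p \<noteq> b"
  shows "p \<notin> closed_segment a b"
proof -
  have "closed_segment a b \<subseteq> convex hull (P - {p})"
    unfolding segment_convex_hull using assms by (intro hull_mono) auto
  then show ?thesis using assms by (auto simp: convex_position_def)
qed

text \<open>Of three collinear points one lies between the other two. The position of
  \<open>r\<close> relative to 0 and 1 tells which one.\<close>

lemma convex_position_not_collinear:
  assumes P: "convex_position P" "a \<in> P" "b \<in> P" "p \<in> P" and ne: "a \<noteq> b" "p \<noteq> a" "p \<noteq> b"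
  shows "p - a \<noteq> r *\<^sub>R (b - a)"
proof
  assume p: "p - a = r *\<^sub>R (b - a)"
  consider "r \<le> 0" | "0 < r" "r \<le> 1" | "r > 1" by linarith
  then show False
  proof cases
    case 1
    \<comment> \<open>The solution of \<open>(1 - u) * r + u = 0\<close>: the weight of
      \<open>b\<close> when \<open>a\<close> is written as a convex combination of \<open>p\<close>
      and \<open>b\<close>.\<close>
    define u where "u = - r / (1 - r)"
    have p': "p = a + r *\<^sub>R (b - a)" using p by (simp add: algebra_simps)
    have "(1 - u) *\<^sub>R p + u *\<^sub>R b = a + ((1 - u) * r + u) *\<^sub>R (b - a)"
      unfolding p' by (simp add: algebra_simps)
    moreover have "(1 - u) * r + u = 0" using 1 by (simp add: u_def field_simps)
    ultimately have "a = (1 - u) *\<^sub>R p + u *\<^sub>R b" by simp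
    moreover have "0 \<le> u" "u \<le> 1" using 1 by (auto simp: u_def divide_simps)
    ultimately have "a \<in> closed_segment p b" by (auto simp: in_segment)
    then show False using convex_position_not_between[of P p b a] assms by auto
  next
    case 2
    have "p = (1 - r) *\<^sub>R a + r *\<^sub>R b" using p by (simp add: algebra_simps)
    then have "p \<in> closed_segment a b" using 2 by (metis in_segment(1) less_imp_le)
    then show False using convex_position_not_between[of P a b p] assms by auto
  next
    case 3
    have "b - a = (1 / r) *\<^sub>R (p - a)" using p 3 by simp
    then have "b = (1 - 1 / r) *\<^sub>R a + (1 / r) *\<^sub>R p" by (simp add: algebra_simps)
    moreover have "0 \<le> 1 / r" "1 / r \<le> 1" using 3 by auto
    ultimately have "b \<in> closed_segment a p" unfolding in_segment by blast
    then show False using convex_position_not_between[of P a p b] assms by auto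
  qed
qed

text \<open>Every point of \<open>P\<close> is an endpoint of a hull edge; \<open>m\<close> is the
  outer normal of that edge.\<close>

lemma convex_position_hull_edge:
  assumes fin: "finite P" and P: "convex_position P" and a: "a \<in> P" and ne: "P \<noteq> {a}"
  obtains b m where "b \<in> P" "b \<noteq> a" "m \<noteq> 0" "m \<bullet> b = m \<bullet> a"
    "\<And>p. p \<in> P - {a, b} \<Longrightarrow> m \<bullet> p < m \<bullet> a"
proof -
  have "a \<notin> convex hull (P - {a})" using P a by (auto simp: convex_position_def)
  moreover have "closed (convex hull (P - {a}))"
    using fin by (simp add: compact_convex_hull compact_imp_closed finite_imp_compact)
  ultimately obtain k c where k: "k \<bullet> a < c" "\<forall>x \<in> convex hull (P - {a}). c < k \<bullet> x"
    using separating_hyperplane_closed_point[of "convex hull (P - {a})" a] by auto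
  have pos: "k \<bullet> (p - a) > 0" if "p \<in> P - {a}" for p
    using k that hull_inc[of p "P - {a}"] by (fastforce simp: inner_diff_right)
  obtain q where q: "q \<in> P - {a}" using a ne by auto
  have "k \<noteq> 0" using pos[OF q] by auto
  then obtain w where w: "w \<noteq> 0" "w \<bullet> k = 0" by (rule orthogonal_vector_exists)
  \<comment> \<open>All of \<open>P - {a}\<close> lies on one side of a line through \<open>a\<close>; the point of largest slope as seen
    from \<open>a\<close> spans a hull edge with \<open>a\<close>.\<close>
  define s where "s p = (w \<bullet> (p - a)) / (k \<bullet> (p - a))" for p
  have "finite (s ` (P - {a}))" "s ` (P - {a}) \<noteq> {}" using fin q by auto
  then obtain b where b: "b \<in> P - {a}" and max: "\<And>p. p \<in> P - {a} \<Longrightarrow> s p \<le> s b"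
    using Max_in[of "s ` (P - {a})"] Max_ge[of "s ` (P - {a})"] by fastforce
  define m where "m = w - s b *\<^sub>R k"
  \<comment> \<open>The second factor is positive, so maximality of \<open>s b\<close> puts
    \<open>P\<close> on one side of the line through \<open>a\<close> and \<open>b\<close>.\<close>
  have m: "m \<bullet> (p - a) = (s p - s b) * (k \<bullet> (p - a))" if "p \<in> P - {a}" for p
    using pos[OF that] by (simp add: m_def s_def inner_diff_left field_simps)
  have "w \<bullet> m = w \<bullet> w" using w by (simp add: m_def inner_diff_right)
  then have m0: "m \<noteq> 0" using w by auto
  have mb: "m \<bullet> (b - a) = 0" using m[OF b] by simp
  show thesis
  proof
    show "b \<in> P" "b \<noteq> a" "m \<noteq> 0" "m \<bullet> b = m \<bullet> a"
      using b m0 mb by (auto simp: inner_diff_right)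
    fix p assume p: "p \<in> P - {a, b}"
    have "m \<bullet> (p - a) \<le> 0"
      using m[of p] max[of p] pos[of p] p by (simp add: mult_nonpos_nonneg)
    moreover have "m \<bullet> (p - a) \<noteq> 0"
    proof
      assume "m \<bullet> (p - a) = 0"
      then obtain r where "p - a = r *\<^sub>R (b - a)"
        using parallel_if_common_normal[of m "b - a" "p - a"] m0 mb b by auto
      then show False using convex_position_not_collinear[OF P a, of b p r] b p by auto
    qed
    ultimately show "m \<bullet> p < m \<bullet> a" by (simp add: inner_diff_right)
  qed
qed

section \<open>Covering the outside of the hull\<close>

text \<open>The region \<open>K\<close> replaces the plane so that the induction can continue inside
  an inner half-plane. The edges left uncovered on the way all lie in the hull of the original
  \<open>P\<close>.\<close>

lemma cover_outside_convex_hull: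
  assumes "finite P" "convex_position P" "convex K" "P \<subseteq> K"
  shows "\<exists>F. finite F \<and> card F \<le> (card P + 1) div 2 + 1 \<and>
    (\<forall>C\<in>F. convex C \<and> C \<subseteq> K - P) \<and> K \<subseteq> convex hull P \<union> \<Union>F"
  using assms
proof (induction "card P" arbitrary: P K rule: less_induct)
  case less
  consider "P = {}" | a where "P = {a}" | a where "a \<in> P" "P \<noteq> {a}" by auto
  then show ?case
  proof cases
    case 1
    then show ?thesis using less.prems by (intro exI[of _ "{K}"]) auto
  next
    case (2 a)
    obtain v :: "real ^ 2" where v: "v \<noteq> 0" using zero_neq_one by metis
    then obtain w where w: "w \<noteq> 0" "w \<bullet> v = 0" by (rule orthogonal_vector_exists)
    \<comment> \<open>\<open>A\<close> and \<open>B\<close> are reflections of each other in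
      \<open>a\<close>; as \<open>w\<close> and \<open>v\<close> are orthogonal, only
      \<open>a\<close> escapes both.\<close>
    define A where "A = lex_halfspace w (w \<bullet> a) v (v \<bullet> a)"
    define B where "B = lex_halfspace (- w) (- w \<bullet> a) (- v) (- v \<bullet> a)"
    have "x \<in> {a} \<union> A \<union> B" for x
    proof (cases "w \<bullet> (x - a) = 0 \<and> v \<bullet> (x - a) = 0")
      case True
      then obtain r where r: "x - a = r *\<^sub>R v"
        using parallel_if_common_normal[of w v "x - a"] v w by auto
      then have "r * (v \<bullet> v) = 0" using True by simp
      then show ?thesis using r v by auto
    next
      case False
      then show ?thesis by (auto simp: A_def B_def lex_halfspace_def inner_diff_right)
    qed
    moreover have "a \<notin> A" "a \<notin> B" by (auto simp: A_def B_def lex_halfspace_def)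
    moreover have "convex A" "convex B" by (simp_all add: A_def B_def convex_lex_halfspace)
    ultimately show ?thesis
      using 2 less.prems
      by (intro exI[of _ "{K \<inter> A, K \<inter> B}"]) (auto simp: card_insert_if convex_Int)
  next
    case (3 a)
    obtain b m where b: "b \<in> P" "b \<noteq> a" and m: "m \<noteq> 0" "m \<bullet> b = m \<bullet> a"
      and below: "\<And>p. p \<in> P - {a, b} \<Longrightarrow> m \<bullet> p < m \<bullet> a"
      using convex_position_hull_edge[of P a] less.prems 3 by blast
    define d where "d = b - a"
    have "d \<bullet> d > 0" using b by (simp add: d_def)
    then have dab: "d \<bullet> a < d \<bullet> b" by (simp add: d_def inner_diff_right)
    \<comment> \<open>\<open>L\<close> lies beyond the edge and takes the ray from \<open>a\<close>
      away from \<open>b\<close>; \<open>K'\<close> lies on the inner side and takes the ray from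
      \<open>b\<close> away from \<open>a\<close>.\<close>
    define L where "L = K \<inter> lex_halfspace m (m \<bullet> a) (- d) (- d \<bullet> a)"
    define K' where "K' = K \<inter> lex_halfspace (- m) (- m \<bullet> a) d (d \<bullet> b)"
    define P' where "P' = P - {a, b}"
    have conv: "convex L" "convex K'"
      using less.prems by (auto simp: L_def K'_def intro!: convex_Int convex_lex_halfspace)
    have P': "finite P'" "convex_position P'" "P' \<subseteq> K'"
      using less.prems below
      by (auto simp: P'_def K'_def lex_halfspace_def intro: convex_position_subset[of P])
    have "card {a, b} \<le> card P" using less.prems 3 b by (intro card_mono) auto
    then have card: "card P = card P' + 2"
      using less.prems 3 b by (simp add: P'_def card_Diff_subset)
    obtain F where F: "finite F" "card F \<le> (card P' + 1) div 2 + 1"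
      "\<forall>C\<in>F. convex C \<and> C \<subseteq> K' - P'" "K' \<subseteq> convex hull P' \<union> \<Union>F"
      using less.hyps[of P' K'] card P' conv by auto
    have "K - K' - L \<subseteq> closed_segment a b"
    proof
      fix x assume "x \<in> K - K' - L"
      then have x: "m \<bullet> x = m \<bullet> a" "d \<bullet> a \<le> d \<bullet> x" "d \<bullet> x \<le> d \<bullet> b"
        by (auto simp: L_def K'_def lex_halfspace_def)
      then obtain r where r: "x - a = r *\<^sub>R d"
        using parallel_if_common_normal[of m d "x - a"] m b by (auto simp: d_def inner_diff_right)
      have "d \<bullet> (x - a) = r * (d \<bullet> d)" "d \<bullet> (b - a) = d \<bullet> d" by (simp_all add: r d_def)
      then have "0 \<le> r * (d \<bullet> d)" "r * (d \<bullet> d) \<le> 1 * (d \<bullet> d)"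
        using x by (simp_all add: inner_diff_right)
      then have "0 \<le> r" "r \<le> 1"
        using \<open>d \<bullet> d > 0\<close> by (simp_all add: zero_le_mult_iff mult_le_cancel_right)
      moreover have "x = (1 - r) *\<^sub>R a + r *\<^sub>R b" using r by (simp add: d_def algebra_simps)
      ultimately show "x \<in> closed_segment a b" by (auto simp: in_segment)
    qed
    also have "\<dots> \<subseteq> convex hull P"
      unfolding segment_convex_hull using b 3 by (intro hull_mono) auto
    finally have "K \<subseteq> convex hull P \<union> \<Union>(insert L F)"
      using F(4) hull_mono[of P' P convex] by (auto simp: P'_def)
    moreover have "L \<subseteq> K - P"
      using m dab below by (force simp: L_def lex_halfspace_def)
    moreover have "K' - P' \<subseteq> K - P"
      using m dab by (auto simp: K'_def P'_def lex_halfspace_def)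
    \<comment> \<open>Dropping two points lowers \<open>(card P + 1) div 2\<close> by exactly one,
      which pays for \<open>L\<close>.\<close>
    moreover have "card (insert L F) \<le> (card P + 1) div 2 + 1"
      using F card by (simp add: card_insert_if)
    moreover have "\<forall>C\<in>insert L F. convex C \<and> C \<subseteq> K - P"
      using F(3) conv calculation(2,3) by blast
    ultimately show ?thesis
      using F(1) by (intro exI[of _ "insert L F"]) blast
  qed
qed

section \<open>Triangles\<close>

lemma triangle_side_normal:
  assumes P: "convex_position P" "a \<in> P" "b \<in> P" "c \<in> P" and ne: "a \<noteq> b" "b \<noteq> c" "c \<noteq> a"
  obtains m where "m \<noteq> 0" "m \<bullet> b = m \<bullet> a" "m \<bullet> a < m \<bullet> c"
proof -
  obtain w where w: "w \<noteq> 0" "w \<bullet> (b - a) = 0"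
    using ne orthogonal_vector_exists[of "b - a"] by auto
  have "w \<bullet> (c - a) \<noteq> 0"
  proof
    assume "w \<bullet> (c - a) = 0"
    then obtain r where "c - a = r *\<^sub>R (b - a)"
      using parallel_if_common_normal[of w "b - a" "c - a"] w ne by auto
    then show False using convex_position_not_collinear[of P a b c r] assms by auto
  qed
  then show thesis
    using w that[of w] that[of "- w"] by (fastforce simp: inner_diff_right)
qed

lemma convex_cover_triangle:
  assumes P: "convex_position P" and abc: "P = {a, b, c}" "a \<noteq> b" "b \<noteq> c" "c \<noteq> a"
  shows "\<exists>F. finite F \<and> card F \<le> 3 \<and> convex_cover P F"
proof -
  obtain u where u: "u \<noteq> 0" "u \<bullet> c = u \<bullet> b" "u \<bullet> b < u \<bullet> a"
    using triangle_side_normal[of P b c a] assms by auto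
  obtain v where v: "v \<noteq> 0" "v \<bullet> c = v \<bullet> a" "v \<bullet> a < v \<bullet> b"
    using triangle_side_normal[of P a c b] assms by auto
  obtain w where w: "w \<noteq> 0" "w \<bullet> b = w \<bullet> a" "w \<bullet> a < w \<bullet> c"
    using triangle_side_normal[of P a b c] assms by auto
  \<comment> \<open>\<open>X\<close> lies beyond the side \<open>bc\<close>, with the ray from
    \<open>c\<close> away from \<open>b\<close>; \<open>Y\<close> lies beyond \<open>ab\<close>,
    with the ray from \<open>a\<close> away from \<open>b\<close>.\<close>
  define X where "X = lex_halfspace (- u) (- u \<bullet> b) (- v) (- v \<bullet> a)"
  define Y where "Y = lex_halfspace (- w) (- w \<bullet> b) (- v) (- v \<bullet> a)"
  \<comment> \<open>The open cone at \<open>b\<close> together with the open sides \<open>bc\<close>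
    and \<open>ba\<close>. On the closed cone the last condition fails only at the apex
    \<open>b\<close>.\<close>
  define Z where "Z = lex_halfspace u (u \<bullet> b) v (v \<bullet> a) \<inter> lex_halfspace w (w \<bullet> b) v (v \<bullet> a)
    \<inter> {x. (u + w) \<bullet> x > (u + w) \<bullet> b}"
  \<comment> \<open>The functional \<open>k\<close> separates \<open>p\<close> from
    \<open>q\<close>, so it is injective on the line through them.\<close>
  have eq: "x = p" if n: "n \<noteq> 0" "n \<bullet> x = n \<bullet> p" "n \<bullet> q = n \<bullet> p" and k: "k \<bullet> x = k \<bullet> p" "k \<bullet> p \<noteq> k \<bullet> q"
    for n k p q x :: "real ^ 2"
  proof -
    have "q - p \<noteq> 0" using k by auto
    then obtain r where r: "x - p = r *\<^sub>R (q - p)"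
      using parallel_if_common_normal[of n "q - p" "x - p"] n by (auto simp: inner_diff_right)
    have "k \<bullet> (x - p) = r * (k \<bullet> (q - p))" by (simp add: r)
    then have "r = 0" using k by (simp add: inner_diff_right)
    then show ?thesis using r by simp
  qed
  have cover: "x \<in> X \<union> Y \<union> Z \<union> P" for x
  proof -
    \<comment> \<open>A point missed by \<open>X\<close>, \<open>Y\<close> and \<open>Z\<close> lies
      on two of the three side lines, hence is a vertex.\<close>
    have "x = c" if "u \<bullet> x = u \<bullet> b" "v \<bullet> x = v \<bullet> a"
      by (rule eq[of u x c b v]) (use u v that in simp_all)
    moreover have "x = a" if "w \<bullet> x = w \<bullet> b" "v \<bullet> x = v \<bullet> a"
      by (rule eq[of w x a b v]) (use w v that in simp_all)
    moreover have "x = b" if "u \<bullet> x = u \<bullet> b" "w \<bullet> x = w \<bullet> b"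
      by (rule eq[of u x b c w]) (use u w that in simp_all)
    ultimately show ?thesis
      unfolding X_def Y_def Z_def lex_halfspace_def abc(1)
      by (simp add: inner_add_left) (smt (verit))
  qed
  have "X \<subseteq> - P" "Y \<subseteq> - P" "Z \<subseteq> - P"
    using u v w by (auto simp: X_def Y_def Z_def lex_halfspace_def abc(1) inner_add_left)
  moreover have "convex X" "convex Y" "convex Z"
    by (auto simp: X_def Y_def Z_def intro!: convex_Int convex_lex_halfspace convex_halfspace_gt)
  ultimately have "convex_cover P {X, Y, Z}"
    using cover by (auto simp: convex_cover_def)
  moreover have "card {X, Y, Z} \<le> 3" by (simp add: card_insert_if)
  ultimately show ?thesis by (intro exI[of _ "{X, Y, Z}"]) simp
qed

section \<open>The bound\<close>

text \<open>The punctured hull adds one set to the cover of the outside, giving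
  \<open>(card P + 5) div 2\<close>. For at most one point the punctured hull is empty, which saves
  one set; three points are handled by the triangle cover.\<close>

lemma convex_cover_bound:
  assumes fin: "finite P" and P: "convex_position P"
  shows "\<exists>F. finite F \<and> card F \<le> (card P + 5) div 2 - delta (card P) \<and> convex_cover P F"
proof -
  obtain F where F: "finite F" "card F \<le> (card P + 1) div 2 + 1"
    "\<forall>C\<in>F. convex C \<and> C \<subseteq> UNIV - P" "UNIV \<subseteq> convex hull P \<union> \<Union>F"
    using cover_outside_convex_hull[OF assms, of UNIV] by auto
  consider "card P = 3" | "card P \<le> 1" | "card P \<noteq> 3" "card P > 1" by linarith
  then show ?thesis
  proof cases
    case 1
    then obtain a b c where "P = {a, b, c}" "a \<noteq> b" "b \<noteq> c" "c \<noteq> a"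
      by (metis card_3_iff)
    then show ?thesis using convex_cover_triangle[OF P] 1 by (auto simp: delta_def)
  next
    case 2
    then have "card P = 0 \<or> card P = 1" by linarith
    then have "convex hull P = P" using fin by (auto simp: card_1_singleton_iff)
    then have "convex_cover P F" using F by (auto simp: convex_cover_def)
    moreover have "(card P + 1) div 2 + 1 \<le> (card P + 5) div 2 - delta (card P)"
      by (auto simp: delta_def)
    ultimately show ?thesis using F by (intro exI[of _ F]) auto
  next
    case 3
    have "convex_cover P (insert (convex hull P - P) F)"
      using F convex_hull_minus_points[OF assms] by (auto simp: convex_cover_def)
    moreover have "card (insert (convex hull P - P) F) \<le> (card P + 5) div 2 - delta (card P)"
      using F 3 by (auto simp: delta_def card_insert_if)
    ultimately show ?thesis using F by (intro exI[of _ "insert (convex hull P - P) F"]) auto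
  qed
qed

theorem theorem3:
  fixes n :: nat
  shows "(\<forall>P :: (real ^ 2) set. finite P \<and> card P = n \<and> convex_position P \<longrightarrow>
            (\<exists>F. finite F \<and> card F \<le> (n + 5) div 2 - delta n \<and> convex_cover P F))
         \<and> covc n \<le> enat ((n + 5) div 2 - delta n)"
proof
  show cover: "\<forall>P :: (real ^ 2) set. finite P \<and> card P = n \<and> convex_position P \<longrightarrow>
            (\<exists>F. finite F \<and> card F \<le> (n + 5) div 2 - delta n \<and> convex_cover P F)"
    using convex_cover_bound by blast
  show "covc n \<le> enat ((n + 5) div 2 - delta n)"
    unfolding covc_def
  proof (rule Sup_least, clarify)
    fix P :: "(real ^ 2) set"
    assume "finite P" "convex_position P" "n = card P"
    then obtain F where F: "finite F" "card F \<le> (card P + 5) div 2 - delta (card P)" "convex_cover P F"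
      using cover by blast
    then have "cov P \<le> enat (card F)" unfolding cov_def by (intro Inf_lower) auto
    also have "\<dots> \<le> enat ((card P + 5) div 2 - delta (card P))" using F by simp
    finally show "cov P \<le> enat ((card P + 5) div 2 - delta (card P))" .
  qed
qed

end
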